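(* Let $n\ge 2$ and let $A=(a_{ij})\in M_R$ be a reciprocal pairwise comparison matrix of order $n$. Then $A\in M_C$ (i.e. $A$ is consistent) if and only if $RIC(A)=0$.
   Context: $M_R$ is the set of all real $n\times n$ matrices $A=(a_{ij})$ with $a_{ij}>0$ for all $i,j$ and $a_{ij}=1/a_{ji}$ for all $i,j$ (reciprocal matrices). $M_C$ is the set of all real $n\times n$ matrices with $a_{ij}>0$ for all $i,j$ and $a_{ij}a_{jk}=a_{ik}$ for all $i,j,k$ (consistent matrices). For $A\in M_R$ let $r_i=(a_{i1},\dots,a_{in})$ be its $i$-th row, let $\varphi_{ij}$ be the angle between $r_i$ and $r_j$, so $\cos\varphi_{ij}=\frac{r_i\cdot r_j}{|r_i|\,|r_j|}$ (Euclidean dot product and norm). The row inconsistency index is $RIC(A)=1-\frac{2\sum_{i=1}^{n-1}\sum_{j=i+1}^{n}\cos\varphi_{ij}}{n(n-1)}$. *)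

theory Defs
  imports "HOL-Analysis.Analysis"
begin

text \<open>Matrices of order \<open>n\<close> have type \<open>real ^ 'n ^ 'n\<close> with \<open>n = CARD('n)\<close>. The index type is a
  finite linear order, hence a copy of the ordered set \<open>1 < \<dots> < n\<close>; the order is needed for
  sums over pairs \<open>i < j\<close>.\<close>

definition reciprocal_matrices :: "(real ^ 'n::finite ^ 'n) set" where
  "reciprocal_matrices =
     {A. (\<forall>i j. A $ i $ j > 0) \<and> (\<forall>i j. A $ i $ j = 1 / A $ j $ i)}"

definition consistent_matrices :: "(real ^ 'n::finite ^ 'n) set" where
  "consistent_matrices =
     {A. (\<forall>i j. A $ i $ j > 0) \<and> (\<forall>i j k. A $ i $ j * A $ j $ k = A $ i $ k)}"

definition vec_angle :: "real ^ 'n::finite \<Rightarrow> real ^ 'n \<Rightarrow> real" where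
  "vec_angle x y = arccos ((x \<bullet> y) / (norm x * norm y))"

text \<open>In the outer sum the greatest index contributes an empty inner sum, so letting \<open>i\<close> range
  over all indices agrees with letting it range over \<open>1, \<dots>, n - 1\<close>.\<close>

definition RIC :: "real ^ 'n::{finite,linorder} ^ 'n::{finite,linorder} \<Rightarrow> real" where
  "RIC A = 1 - 2 * (\<Sum>i\<in>UNIV. \<Sum>j\<in>{i<..}. cos (vec_angle (row i A) (row j A)))
                 / (real CARD('n) * (real CARD('n) - 1))"

end

theory Submission
  imports Defs
begin

text \<open>The cosines are at most 1, and there are n(n - 1)/2 of them in the sum, so the index vanishes
  iff every cosine is 1. By the equality case of Cauchy-Schwarz this means that the rows are
  positive multiples of each other, and since the diagonal entries are 1, the factor between
  rows i and j is the entry in position (i, j).\<close>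

text \<open>By Cauchy-Schwarz the quotient lies in [-1, 1], where \<open>cos\<close> inverts
  \<open>arccos\<close>. If a vector is zero, the quotient is 0 because division by zero yields
  0.\<close>

lemma cos_vec_angle: "cos (vec_angle x y) = (x \<bullet> y) / (norm x * norm y)"
proof -
  have "\<bar>(x \<bullet> y) / (norm x * norm y)\<bar> \<le> 1"
    using Cauchy_Schwarz_ineq2[of x y] by (auto simp: divide_le_eq_1 zero_less_mult_iff)
  then show ?thesis
    unfolding vec_angle_def by (intro cos_arccos_abs)
qed

lemma cos_vec_angle_eq_1_iff:
  assumes "x \<noteq> 0" "y \<noteq> 0"
  shows "cos (vec_angle x y) = 1 \<longleftrightarrow> norm x *\<^sub>R y = norm y *\<^sub>R x"
  using assms by (simp add: cos_vec_angle norm_cauchy_schwarz_eq[symmetric]) metis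

text \<open>Each index is comparable with the n - 1 others, and going through all indices meets
  every pair twice.\<close>

lemma double_sum_card_greaterThan:
  "2 * (\<Sum>i::'a::{finite,linorder}\<in>UNIV. real (card {i<..})) =
     real CARD('a) * (real CARD('a) - 1)"
proof -
  have card: "real (card {i<..}) = (\<Sum>j\<in>UNIV. of_bool (i < j))"
             "real (card {..<i}) = (\<Sum>j\<in>UNIV. of_bool (j < i))" for i :: 'a
    by (simp_all add: greaterThan_def lessThan_def)
  \<comment> \<open>Both sums count the pairs of distinct indices, the left one by the smaller index
    and the right one by the larger.\<close>
  have swap: "(\<Sum>i\<in>UNIV. real (card {i::'a<..})) = (\<Sum>i\<in>UNIV. real (card {..<i::'a}))"
    unfolding card by (rule sum.swap)
  have split: "real (card {i<..}) + real (card {..<i}) = real CARD('a) - 1" for i :: 'a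
  proof -
    have "UNIV = insert i ({i<..} \<union> {..<i})"
      by auto
    then have "CARD('a) = card (insert i ({i<..} \<union> {..<i}))"
      by simp
    also have "\<dots> = Suc (card ({i<..} \<union> {..<i}))"
      by (subst card_insert_disjoint) auto
    also have "card ({i<..} \<union> {..<i}) = card {i<..} + card {..<i}"
      by (rule card_Un_disjoint) auto
    finally show ?thesis
      by simp
  qed
  have "2 * (\<Sum>i\<in>UNIV. real (card {i::'a<..})) =
        (\<Sum>i\<in>UNIV. real (card {i<..}) + real (card {..<i::'a}))"
    unfolding sum.distrib using swap by simp
  also have "\<dots> = real CARD('a) * (real CARD('a) - 1)"
    by (simp add: split)
  finally show ?thesis .
qed

lemma RIC_eq_0_iff:
  fixes A :: "real ^ 'n::{finite,linorder} ^ 'n::{finite,linorder}"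
  assumes "CARD('n) \<ge> 2"
  shows "RIC A = 0 \<longleftrightarrow> (\<forall>i j. i < j \<longrightarrow> cos (vec_angle (row i A) (row j A)) = 1)"
proof -
  define c where "c i j = cos (vec_angle (row i A) (row j A))" for i j
  let ?N = "real CARD('n) * (real CARD('n) - 1)"
  have "?N > 0"
    using assms by simp
  then have "RIC A = 0 \<longleftrightarrow> 2 * (\<Sum>i\<in>UNIV. \<Sum>j\<in>{i<..}. c i j) = ?N"
    unfolding RIC_def c_def[symmetric] by (auto simp: divide_eq_eq)
  \<comment> \<open>Writing \<open>?N\<close> as twice a sum of ones over the same pairs allows a
    termwise difference. Its terms \<open>1 - c i j\<close> are nonnegative, so the outer and then
    the inner sums vanish only termwise.\<close>
  also have "\<dots> \<longleftrightarrow> (\<Sum>i\<in>UNIV. \<Sum>j\<in>{i<..}. 1 - c i j) = 0"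
    unfolding double_sum_card_greaterThan[symmetric] sum_subtractf by auto
  also have "\<dots> \<longleftrightarrow> (\<forall>i. (\<Sum>j\<in>{i<..}. 1 - c i j) = 0)"
    by (subst sum_nonneg_eq_0_iff) (auto intro!: sum_nonneg simp: c_def)
  also have "\<dots> \<longleftrightarrow> (\<forall>i j. i < j \<longrightarrow> c i j = 1)"
    by (subst sum_nonneg_eq_0_iff) (auto simp: c_def)
  finally show ?thesis
    unfolding c_def .
qed

lemma consistent_iff_rows_parallel:
  assumes "A \<in> reciprocal_matrices"
  shows "A \<in> consistent_matrices \<longleftrightarrow>
    (\<forall>i j. norm (row i A) *\<^sub>R row j A = norm (row j A) *\<^sub>R row i A)"
proof -
  have pos: "A $ i $ j > 0" and recip: "A $ i $ j = 1 / A $ j $ i" for i j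
    using assms unfolding reciprocal_matrices_def by blast+
  have diag: "A $ i $ i = 1" for i
  proof -
    \<comment> \<open>Reciprocity on the diagonal leaves 1 or -1, and positivity excludes
      -1.\<close>
    have "A $ i $ i * A $ i $ i = 1"
      using recip[of i i] pos[of i i] by (simp add: field_simps)
    with pos[of i i] show ?thesis
      by (simp add: square_eq_1_iff)
  qed
  have nz: "norm (row i A) \<noteq> 0" for i
    using pos[of i i] by (auto simp: vec_eq_iff row_def intro!: exI[of _ i])
  show ?thesis
  proof
    assume "A \<in> consistent_matrices"
    then have row: "row i A = (A $ i $ j) *\<^sub>R row j A" for i j
      by (simp add: consistent_matrices_def vec_eq_iff row_def)
    \<comment> \<open>The factor is positive, so it leaves the norm without an absolute
      value.\<close>
    have "norm (row i A) = A $ i $ j * norm (row j A)" for i j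
      using pos[of i j] by (subst row[of i j]) simp
    then have "norm (row i A) *\<^sub>R row j A = norm (row j A) *\<^sub>R row i A" for i j
      using row[of i j] by (metis mult.commute scaleR_scaleR)
    then show "\<forall>i j. norm (row i A) *\<^sub>R row j A = norm (row j A) *\<^sub>R row i A"
      by blast
  next
    assume par: "\<forall>i j. norm (row i A) *\<^sub>R row j A = norm (row j A) *\<^sub>R row i A"
    have entry: "norm (row i A) * A $ j $ k = norm (row j A) * A $ i $ k" for i j k
      using par[rule_format, of i j] by (simp add: vec_eq_iff row_def)
    have "A $ i $ j * A $ j $ k = A $ i $ k" for i j k
    proof -
      \<comment> \<open>Column \<open>j\<close>, where row \<open>j\<close> has entry 1, identifies
        \<open>A $ i $ j\<close> as the ratio of the norms of rows \<open>i\<close> and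
        \<open>j\<close>; column \<open>k\<close> then gives the claim.\<close>
      have "norm (row j A) * (A $ i $ j * A $ j $ k) = norm (row j A) * A $ i $ k"
        using entry[of i j j] entry[of i j k] by (simp add: diag)
      then show ?thesis
        using nz[of j] by simp
    qed
    with pos show "A \<in> consistent_matrices"
      by (simp add: consistent_matrices_def)
  qed
qed

theorem proposition1:
  fixes A :: "real ^ 'n::{finite,linorder} ^ 'n::{finite,linorder}"
  assumes "CARD('n) \<ge> 2"
    and "A \<in> reciprocal_matrices"
  shows "A \<in> consistent_matrices \<longleftrightarrow> RIC A = 0"
proof -
  have "A $ i $ i > 0" for i
    using assms(2) unfolding reciprocal_matrices_def by blast
  then have nz: "row i A \<noteq> 0" for i
    by (metis less_irrefl row_def vec_lambda_eta zero_index)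
  let ?P = "\<lambda>i j. norm (row i A) *\<^sub>R row j A = norm (row j A) *\<^sub>R row i A"
  have "RIC A = 0 \<longleftrightarrow> (\<forall>i j. i < j \<longrightarrow> ?P i j)"
    by (simp add: RIC_eq_0_iff[OF assms(1)] cos_vec_angle_eq_1_iff nz)
  \<comment> \<open>\<open>?P\<close> is symmetric and trivial for equal indices, so the pairs with
    \<open>i < j\<close> suffice.\<close>
  also have "\<dots> \<longleftrightarrow> (\<forall>i j. ?P i j)"
    by (metis linorder_less_linear)
  finally show ?thesis
    using consistent_iff_rows_parallel[OF assms(2)] by simp
qed

end
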